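(* For every $k\le n/2$, every RTLW($k$) refutation of $FPHP_n$ has size $2^{\Omega(n\log n)}$; that is, there is a constant $c>0$ such that for all sufficiently large $n$ and all $k\le n/2$, every RTLW($k$) refutation of $FPHP_n$ has size at least $2^{c\,n\log n}$.
   Context: $FPHP_n$ is the set of clauses in the variables $x_{i,j}$ ($1\le i\le n+1$, $1\le j\le n$) consisting of: the pigeon clauses $P_i=\{x_{i,j}:1\le j\le n\}$ for $1\le i\le n+1$; the hole clauses $\{\overline x_{i,j},\overline x_{i',j}\}$ for $1\le i<i'\le n+1$, $1\le j\le n$; and the functional clauses $\{\overline x_{i,j},\overline x_{i,j'}\}$ for $1\le i\le n+1$, $1\le j<j'\le n$. Clauses are finite sets of literals; $\Box$ the empty clause. Resolution: from $C_0\ni x$, $C_1\ni\overline x$ infer $(C_0\setminus\{x\})\cup(C_1\setminus\{\overline x\})$; weakening: from $C$ infer any $C'\supseteq C$. An RTLW refutation of $F$ is an ordered tree $T$ with post-order $<_T$ (for each node, its left subtree before its right subtree before the node) in which each node has $0$, $1$ or $2$ children; each leaf $v$ is labeled by a clause of $F$ or by a clause labeling some node $u<_T v$ (a lemma); each node with two children is labeled by the resolvent of its children's clauses; each node with one child by a weakening of its child's clause; the root is labeled $\Box$. Size = number of nodes. RTLW($k$): every lemma (leaf label not occurring in $F$) has at most $k$ literals. *)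

theory Defs
  imports Complex_Main
begin

datatype 'v lit = Pos 'v | Neg 'v

type_synonym 'v clause = "'v lit set"

definition is_resolvent :: "'v clause \<Rightarrow> 'v clause \<Rightarrow> 'v clause \<Rightarrow> bool" where
  "is_resolvent C0 C1 C \<longleftrightarrow>
     (\<exists>x. Pos x \<in> C0 \<and> Neg x \<in> C1 \<and> C = (C0 - {Pos x}) \<union> (C1 - {Neg x}))"

datatype 'v dtree =
    Leaf (label: "'v clause")
  | Weaken (label: "'v clause") "'v dtree"
  | Resolve (label: "'v clause") "'v dtree" "'v dtree"

text \<open>
  The nodes in post-order, each given by the subtree rooted at it. Distinct nodes may carry
  equal subtrees, so a node is identified by its position in this list; the post-order of the
  tree is then the order of the positions.
\<close>

primrec nodes :: "'v dtree \<Rightarrow> 'v dtree list" where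
  "nodes (Leaf C) = [Leaf C]"
| "nodes (Weaken C t) = nodes t @ [Weaken C t]"
| "nodes (Resolve C l r) = nodes l @ nodes r @ [Resolve C l r]"

definition num_nodes :: "'v dtree \<Rightarrow> nat" where
  "num_nodes T = length (nodes T)"

text \<open>
  Either child of a resolution node may be the one that contains the pivot positively:
  the left-right order of the children matters only for the post-order.
\<close>

definition correct_node :: "'v clause set \<Rightarrow> 'v dtree \<Rightarrow> nat \<Rightarrow> bool" where
  "correct_node F T i \<longleftrightarrow>
     (case nodes T ! i of
        Leaf C \<Rightarrow> C \<in> F \<or> (\<exists>j<i. label (nodes T ! j) = C)
      | Weaken C t \<Rightarrow> label t \<subseteq> C
      | Resolve C l r \<Rightarrow>
          is_resolvent (label l) (label r) C \<or> is_resolvent (label r) (label l) C)"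

definition RTLW_refutation :: "'v clause set \<Rightarrow> 'v dtree \<Rightarrow> bool" where
  "RTLW_refutation F T \<longleftrightarrow>
     (\<forall>i<num_nodes T. finite (label (nodes T ! i)) \<and> correct_node F T i) \<and> label T = {}"

definition lemmas_of :: "'v clause set \<Rightarrow> 'v dtree \<Rightarrow> 'v clause set" where
  "lemmas_of F T = {C. Leaf C \<in> set (nodes T) \<and> C \<notin> F}"

definition RTLW_k_refutation :: "nat \<Rightarrow> 'v clause set \<Rightarrow> 'v dtree \<Rightarrow> bool" where
  "RTLW_k_refutation k F T \<longleftrightarrow>
     RTLW_refutation F T \<and> (\<forall>C\<in>lemmas_of F T. card C \<le> k)"

definition pigeon_clauses :: "nat \<Rightarrow> (nat \<times> nat) clause set" where
  "pigeon_clauses n = {{Pos (i, j) | j. 1 \<le> j \<and> j \<le> n} | i. 1 \<le> i \<and> i \<le> n + 1}"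

definition hole_clauses :: "nat \<Rightarrow> (nat \<times> nat) clause set" where
  "hole_clauses n =
     {{Neg (i, j), Neg (i', j)} | i i' j. 1 \<le> i \<and> i < i' \<and> i' \<le> n + 1 \<and> 1 \<le> j \<and> j \<le> n}"

definition functional_clauses :: "nat \<Rightarrow> (nat \<times> nat) clause set" where
  "functional_clauses n =
     {{Neg (i, j), Neg (i, j')} | i j j'. 1 \<le> i \<and> i \<le> n + 1 \<and> 1 \<le> j \<and> j < j' \<and> j' \<le> n}"

definition FPHP :: "nat \<Rightarrow> (nat \<times> nat) clause set" where
  "FPHP n = pigeon_clauses n \<union> hole_clauses n \<union> functional_clauses n"

end

theory Submission
  imports Defs
begin

text \<open>
  Walking up a tree-like derivation along falsified clauses, an adversary maintains a partial matching \<open>M\<close> of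
  pigeons to holes together with a set \<open>Z\<close> of further variables declared false. Think of a
  threshold drawn independently and uniformly from \<open>{1..K}\<close> for every pigeon: pigeon \<open>i\<close> enters
  its \<open>t\<close>-th still possible queried hole, where \<open>t\<close> is its threshold. The number of thresholds
  consistent with the current position is a product over the unmatched pigeons. It splits
  additively at a query and is at most \<open>K\<^sup>K\<close> at a pigeon clause, because nearly all holes
  are occupied there; so a tree-like derivation from a position with matching \<open>M\<close> has at least
  \<open>K ^ (n + 1 - card M - K)\<close> nodes. The bound follows with \<open>K = n div 4\<close>.

  A clause with at most \<open>n / 2\<close> literals that some position falsifies is already falsified by
  a matching of size at most \<open>n / 2\<close>. Hence the first node in post-order labelled by such a clause
  roots a derivation whose lemmas can never be falsified. The adversary never reaches those lemmas,
  and the tree-like bound applies.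
\<close>

section \<open>Positions of the adversary and their weight\<close>

definition position :: "nat \<Rightarrow> (nat \<times> nat) set \<Rightarrow> (nat \<times> nat) set \<Rightarrow> bool" where
  "position n M Z \<longleftrightarrow> M \<subseteq> {1..n+1} \<times> {1..n} \<and> Z \<subseteq> {1..n+1} \<times> {1..n} \<and> M \<inter> Z = {} \<and>
     inj_on fst M \<and> inj_on snd M"

text \<open>
  Weakening may introduce variables outside the range of \<open>FPHP n\<close>; they count as false throughout.
\<close>

fun falsifies :: "nat \<Rightarrow> (nat \<times> nat) set \<Rightarrow> (nat \<times> nat) set \<Rightarrow> (nat \<times> nat) lit \<Rightarrow> bool" where
  "falsifies n M Z (Neg p) \<longleftrightarrow> p \<in> M"
| "falsifies n M Z (Pos p) \<longleftrightarrow> p \<notin> {1..n+1} \<times> {1..n} \<or> p \<in> Z \<or>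
     (\<exists>q\<in>M. q \<noteq> p \<and> (fst q = fst p \<or> snd q = snd p))"

definition falsifiable :: "nat \<Rightarrow> (nat \<times> nat) clause \<Rightarrow> bool" where
  "falsifiable n C \<longleftrightarrow> (\<exists>M Z. position n M Z \<and> (\<forall>l\<in>C. falsifies n M Z l))"

text \<open>Each entry of \<open>Z\<close> at a pigeon rules out one more of its \<open>K\<close>
  thresholds. Subtraction on naturals truncates, so the weight vanishes once some unmatched pigeon
  has \<open>K\<close> entries.\<close>

definition weight :: "nat \<Rightarrow> nat \<Rightarrow> (nat \<times> nat) set \<Rightarrow> (nat \<times> nat) set \<Rightarrow> nat" where
  "weight n K M Z = (\<Prod>i\<in>{1..n+1} - fst ` M. K - card (Z `` {i}))"

lemma position_finite:
  assumes "position n M Z"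
  shows "finite M" "finite Z" "finite (Z `` {i})"
proof -
  show "finite M" "finite Z"
    using assms unfolding position_def by (meson finite_SigmaI finite_atLeastAtMost finite_subset)+
  then show "finite (Z `` {i})" by (intro finite_Image)
qed

lemma weight_split:
  assumes pos: "position n M Z" and p: "(i, j) \<in> {1..n+1} \<times> {1..n}"
    and "i \<notin> fst ` M" and "(i, j) \<notin> Z"
  shows "weight n K M Z \<le> weight n K (insert (i, j) M) Z + weight n K M (insert (i, j) Z)"
proof -
  let ?A = "{1..n+1} - fst ` M"
  have A: "finite ?A" "i \<in> ?A" using assms by auto
  have eq: "{1..n+1} - fst ` insert (i, j) M = ?A - {i}" by auto
  have "insert (i, j) Z `` {i} = insert j (Z `` {i})" by auto
  moreover have "j \<notin> Z `` {i}" using assms by auto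
  ultimately have card: "card (insert (i, j) Z `` {i}) = Suc (card (Z `` {i}))"
    using position_finite(3)[OF pos] by simp
  have rest: "(\<Prod>a\<in>?A - {i}. K - card (insert (i, j) Z `` {a})) =
      (\<Prod>a\<in>?A - {i}. K - card (Z `` {a}))" (is "_ = ?P")
    by (intro prod.cong refl arg_cong[where f = "\<lambda>S. K - card S"]) auto
  have "weight n K M Z = (K - card (Z `` {i})) * ?P"
    unfolding weight_def by (rule prod.remove[OF A])
  \<comment> \<open>The summand 1 is the threshold that puts \<open>i\<close> into \<open>j\<close>
    now. Equality fails only under truncation, where the left factor is already 0.\<close>
  also have "\<dots> \<le> (1 + (K - Suc (card (Z `` {i})))) * ?P" by (intro mult_right_mono) auto
  also have "\<dots> = ?P + (K - Suc (card (Z `` {i}))) * ?P" by (simp add: algebra_simps)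
  also have "(K - Suc (card (Z `` {i}))) * ?P = weight n K M (insert (i, j) Z)"
    unfolding weight_def prod.remove[OF A] rest card ..
  also have "?P = weight n K (insert (i, j) M) Z" unfolding weight_def eq ..
  finally show ?thesis .
qed

text \<open>Injectivity of the matching rules out hole and functional clauses. For a falsified
  pigeon clause, every hole is occupied or refused by that pigeon, so few refusals force a nearly
  complete matching.\<close>

lemma weight_axiom:
  assumes pos: "position n M Z" and C: "C \<in> FPHP n" and fals: "\<And>l. l \<in> C \<Longrightarrow> falsifies n M Z l"
    and "0 < K" "K \<le> n"
  shows "weight n K M Z \<le> K ^ K"
proof -
  have inj: "inj_on fst M" "inj_on snd M" using pos by (auto simp: position_def)
  have "C \<notin> hole_clauses n"
  proof
    assume "C \<in> hole_clauses n"
    then obtain i i' j where "i < i'" "C = {Neg (i, j), Neg (i', j)}"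
      by (auto simp: hole_clauses_def)
    then show False using fals[of "Neg (i, j)"] fals[of "Neg (i', j)"] inj_onD[OF inj(2), of "(i, j)" "(i', j)"]
      by simp
  qed
  moreover have "C \<notin> functional_clauses n"
  proof
    assume "C \<in> functional_clauses n"
    then obtain i j j' where "j < j'" "C = {Neg (i, j), Neg (i, j')}"
      by (auto simp: functional_clauses_def)
    then show False using fals[of "Neg (i, j)"] fals[of "Neg (i, j')"] inj_onD[OF inj(1), of "(i, j)" "(i, j')"]
      by simp
  qed
  ultimately obtain i where i: "1 \<le> i" "i \<le> n + 1"
      and Ci: "C = {Pos (i, j) | j. 1 \<le> j \<and> j \<le> n}"
    using C by (auto simp: FPHP_def pigeon_clauses_def)
  have f: "falsifies n M Z (Pos (i, j))" if "j \<in> {1..n}" for j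
    using that by (intro fals) (auto simp: Ci)
  \<comment> \<open>If \<open>i\<close> sat in \<open>j\<close>, then \<open>Pos (i, j)\<close>
    could only be falsified by a second pair sharing \<open>i\<close> or \<open>j\<close>, against
    injectivity.\<close>
  have iM: "i \<notin> fst ` M"
  proof
    assume "i \<in> fst ` M"
    then obtain j where j: "(i, j) \<in> M" by force
    then have "j \<in> {1..n}" "(i, j) \<notin> Z" using pos by (auto simp: position_def)
    with f[of j] i obtain q where "q \<in> M" "q \<noteq> (i, j)" "fst q = i \<or> snd q = j" by auto
    then show False using j inj_onD[OF inj(1), of q "(i, j)"] inj_onD[OF inj(2), of q "(i, j)"]
      by auto
  qed
  have "{1..n} \<subseteq> snd ` M \<union> Z `` {i}"
  proof
    fix j assume "j \<in> {1..n}"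
    with f[of j] i iM show "j \<in> snd ` M \<union> Z `` {i}" by force
  qed
  then have "card {1..n} \<le> card (snd ` M \<union> Z `` {i})"
    using position_finite[OF pos] by (intro card_mono) auto
  also have "\<dots> \<le> card (snd ` M) + card (Z `` {i})" by (rule card_Un_le)
  also have "card (snd ` M) = card M" by (rule card_image[OF inj(2)])
  finally have holes: "n \<le> card M + card (Z `` {i})" by simp
  have unmatched: "card ({1..n+1} - fst ` M) = n + 1 - card M"
    using pos position_finite(1)[OF pos] card_image[OF inj(1)]
    by (subst card_Diff_subset) (auto simp: position_def)
  show ?thesis
  proof (cases "K \<le> card (Z `` {i})")
    case True
    then have "weight n K M Z = 0" using i iM unfolding weight_def
      by (intro prod_zero bexI[of _ i]) auto
    then show ?thesis by simp
  next
    case False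
    have "weight n K M Z \<le> (\<Prod>i\<in>{1..n+1} - fst ` M. K)"
      unfolding weight_def by (intro prod_mono) auto
    also have "\<dots> = K ^ (n + 1 - card M)" by (simp only: prod_constant unmatched)
    also have "\<dots> \<le> K ^ K" using False holes assms by (intro power_increasing) auto
    finally show ?thesis .
  qed
qed

section \<open>Weight along tree-like derivations\<close>

lemma position_insert_matching:
  assumes "position n M Z" "(i, j) \<in> {1..n+1} \<times> {1..n}"
    "i \<notin> fst ` M" "j \<notin> snd ` M" "(i, j) \<notin> Z"
  shows "position n (insert (i, j) M) Z"
  using assms unfolding position_def by (auto simp: inj_on_insert)

lemma falsifies_mono:
  "falsifies n M Z l \<Longrightarrow> M \<subseteq> M' \<Longrightarrow> Z \<subseteq> Z' \<Longrightarrow> falsifies n M' Z' l"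
  by (cases l) auto

text \<open>A version of \<open>correct_node\<close> that does not look at earlier nodes, so it can
  be inherited by subtrees; admissible lemmas are put into \<open>F\<close>.\<close>

fun derivation_step :: "'v clause set \<Rightarrow> 'v dtree \<Rightarrow> bool" where
  "derivation_step F (Leaf C) \<longleftrightarrow> C \<in> F"
| "derivation_step F (Weaken C t) \<longleftrightarrow> label t \<subseteq> C"
| "derivation_step F (Resolve C l r) \<longleftrightarrow>
     is_resolvent (label l) (label r) C \<or> is_resolvent (label r) (label l) C"

text \<open>The adversary queries the pivot: a positive answer leads to the premise
  \<open>C1\<close>, a negative one to \<open>C0\<close>, and the weight is shared between the two
  answers.\<close>

lemma weight_resolve:
  assumes pos: "position n M Z" and fals: "\<And>l. l \<in> C \<Longrightarrow> falsifies n M Z l"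
    and res: "is_resolvent C0 C1 C"
    and b0: "\<And>M Z. position n M Z \<Longrightarrow> (\<And>l. l \<in> C0 \<Longrightarrow> falsifies n M Z l) \<Longrightarrow> weight n K M Z \<le> a"
    and b1: "\<And>M Z. position n M Z \<Longrightarrow> (\<And>l. l \<in> C1 \<Longrightarrow> falsifies n M Z l) \<Longrightarrow> weight n K M Z \<le> b"
  shows "weight n K M Z \<le> a + b"
proof -
  obtain i j where C: "C = (C0 - {Pos (i, j)}) \<union> (C1 - {Neg (i, j)})"
    using res by (auto simp: is_resolvent_def)
  show ?thesis
  proof (cases "falsifies n M Z (Pos (i, j)) \<or> falsifies n M Z (Neg (i, j))")
    case True
    then show ?thesis
    proof
      assume "falsifies n M Z (Pos (i, j))"
      then have "\<And>l. l \<in> C0 \<Longrightarrow> falsifies n M Z l" using fals C by blast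
      then show ?thesis using b0[OF pos] by force
    next
      assume "falsifies n M Z (Neg (i, j))"
      then have "\<And>l. l \<in> C1 \<Longrightarrow> falsifies n M Z l" using fals C by blast
      then show ?thesis using b1[OF pos] by force
    qed
  next
    \<comment> \<open>An undecided pivot is in range and clashes with no pair of \<open>M\<close>,
      so both answers again give positions.\<close>
    case False
    then have p: "(i, j) \<in> {1..n+1} \<times> {1..n}" "(i, j) \<notin> Z" "(i, j) \<notin> M"
      and q: "i \<notin> fst ` M" "j \<notin> snd ` M" by auto
    have "weight n K (insert (i, j) M) Z \<le> b"
    proof (rule b1)
      show "position n (insert (i, j) M) Z" using position_insert_matching[OF pos p(1) q p(2)] .
      show "falsifies n (insert (i, j) M) Z l" if "l \<in> C1" for l
      proof (cases "l = Neg (i, j)")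
        case False
        then show ?thesis using that fals[of l] C by (blast intro: falsifies_mono)
      qed simp
    qed
    moreover have "weight n K M (insert (i, j) Z) \<le> a"
    proof (rule b0)
      show "position n M (insert (i, j) Z)" using pos p by (auto simp: position_def)
      show "falsifies n M (insert (i, j) Z) l" if "l \<in> C0" for l
      proof (cases "l = Pos (i, j)")
        case False
        then show ?thesis using that fals[of l] C by (blast intro: falsifies_mono)
      qed simp
    qed
    ultimately show ?thesis using weight_split[OF pos p(1) q(1) p(2), of K] by simp
  qed
qed

text \<open>Unfalsifiable clauses are free extra axioms: the walk only visits falsified clauses, so
  it ends in a leaf from \<open>FPHP n\<close>, which absorbs weight at most
  \<open>K ^ K\<close>.\<close>

lemma weight_le_num_nodes:
  assumes "0 < K" "K \<le> n"
    and "\<And>s. s \<in> set (nodes T) \<Longrightarrow> derivation_step (FPHP n \<union> {C. \<not> falsifiable n C}) s"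
    and "position n M Z" "\<And>l. l \<in> label T \<Longrightarrow> falsifies n M Z l"
  shows "weight n K M Z \<le> num_nodes T * K ^ K"
  using assms(3-5)
proof (induction T arbitrary: M Z)
  case (Leaf C)
  then have "falsifiable n C" unfolding falsifiable_def by (metis dtree.sel(1))
  then have "C \<in> FPHP n" using Leaf.prems(1)[of "Leaf C"] by simp
  then have "weight n K M Z \<le> K ^ K"
    using Leaf.prems(3) by (intro weight_axiom[OF Leaf.prems(2) _ _ assms(1,2)]) simp_all
  then show ?case by (simp add: num_nodes_def)
next
  case (Weaken C t)
  have "label t \<subseteq> C" using Weaken.prems(1)[of "Weaken C t"] by simp
  then have "\<And>l. l \<in> label t \<Longrightarrow> falsifies n M Z l" using Weaken.prems(3) by auto
  with Weaken.prems(1,2) have "weight n K M Z \<le> num_nodes t * K ^ K"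
    by (intro Weaken.IH) simp_all
  then show ?case by (simp add: num_nodes_def)
next
  case (Resolve C l r)
  have l: "weight n K M Z \<le> num_nodes l * K ^ K"
    if "position n M Z" "\<And>x. x \<in> label l \<Longrightarrow> falsifies n M Z x" for M Z
    by (rule Resolve.IH(1)) (simp_all add: Resolve.prems(1) that)
  have r: "weight n K M Z \<le> num_nodes r * K ^ K"
    if "position n M Z" "\<And>x. x \<in> label r \<Longrightarrow> falsifies n M Z x" for M Z
    by (rule Resolve.IH(2)) (simp_all add: Resolve.prems(1) that)
  have C: "falsifies n M Z x" if "x \<in> C" for x using Resolve.prems(3) that by simp
  have "is_resolvent (label l) (label r) C \<or> is_resolvent (label r) (label l) C"
    using Resolve.prems(1)[of "Resolve C l r"] by simp
  then have "weight n K M Z \<le> num_nodes l * K ^ K + num_nodes r * K ^ K"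
  proof
    assume res: "is_resolvent (label l) (label r) C"
    show ?thesis by (rule weight_resolve[OF Resolve.prems(2) _ res]) (fact C l r)+
  next
    assume res: "is_resolvent (label r) (label l) C"
    have "weight n K M Z \<le> num_nodes r * K ^ K + num_nodes l * K ^ K"
      by (rule weight_resolve[OF Resolve.prems(2) _ res]) (fact C l r)+
    then show ?thesis by simp
  qed
  then show ?case by (simp add: num_nodes_def algebra_simps)
qed

section \<open>Falsifying short clauses by small matchings\<close>

text \<open>Greedy extension: each pigeon of \<open>I\<close> takes a hole that is free and not
  forbidden for it by \<open>P\<close>.\<close>

lemma extend_matching:
  assumes "position n M {}" "finite P" "finite I" "I \<subseteq> {1..n+1}" "M \<inter> P = {}"
    and "card M + card I + card P \<le> n"
  shows "\<exists>M'. position n M' {} \<and> M \<subseteq> M' \<and> M' \<inter> P = {} \<and> I \<subseteq> fst ` M' \<and>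
    card M' \<le> card M + card I"
  using assms(3,4,6)
proof (induction I)
  case empty
  then show ?case using assms(1,5) by (intro exI[of _ M]) auto
next
  case (insert i I)
  then obtain M' where M': "position n M' {}" "M \<subseteq> M'" "M' \<inter> P = {}" "I \<subseteq> fst ` M'"
      "card M' \<le> card M + card I" by auto
  show ?case
  proof (cases "i \<in> fst ` M'")
    case True
    then show ?thesis using M' insert by (intro exI[of _ M']) auto
  next
    case False
    have fin: "finite M'" "finite (P `` {i})"
      using position_finite(1)[OF M'(1)] assms(2) by (auto intro: finite_Image)
    have "P `` {i} \<subseteq> snd ` P" by force
    then have "card (P `` {i}) \<le> card P"
      using assms(2) by (meson card_image_le card_mono finite_imageI order_trans)
    moreover have "card (snd ` M') \<le> card M'" using fin by (intro card_image_le)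
    \<comment> \<open>Strict because \<open>i\<close> itself is still counted in the assumed budget
      \<open>n\<close>.\<close>
    ultimately have "card (snd ` M' \<union> P `` {i}) < card {1..n}"
      using card_Un_le[of "snd ` M'" "P `` {i}"] M'(5) insert by simp
    then have "\<not> {1..n} \<subseteq> snd ` M' \<union> P `` {i}"
      using fin by (meson card_mono finite_Un finite_imageI not_less)
    then obtain j where j: "j \<in> {1..n}" "j \<notin> snd ` M'" "(i, j) \<notin> P"
      by (metis Image_singleton_iff UnI1 UnI2 subsetI)
    have "position n (Set.insert (i, j) M') {}"
      using j insert.prems by (intro position_insert_matching M' False) auto
    moreover have "card (Set.insert (i, j) M') \<le> card M + card (Set.insert i I)"
      using fin M'(5) insert by (simp add: card_insert_if)
    ultimately show ?thesis using j M' by (intro exI[of _ "Set.insert (i, j) M'"]) auto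
  qed
qed

text \<open>Negative literals fix pairs of the matching. The pigeon of a positive literal is sent to
  some other hole, so the clash falsifies the literal and no entry of \<open>Z\<close> is
  needed.\<close>

lemma falsifiable_by_matching:
  assumes "finite C" "2 * card C \<le> n" "falsifiable n C"
  shows "\<exists>M. position n M {} \<and> card M \<le> card C \<and> (\<forall>l\<in>C. falsifies n M {} l)"
proof -
  obtain M Z where MZ: "position n M Z" and fals: "\<forall>l\<in>C. falsifies n M Z l"
    using assms by (auto simp: falsifiable_def)
  define N where "N = {p. Neg p \<in> C}"
  define P where "P = {p. Pos p \<in> C}"
  \<comment> \<open>Positive literals whose pigeon is out of range are false anyway.\<close>
  define I where "I = fst ` P \<inter> {1..n+1}"
  have C: "C = Neg ` N \<union> Pos ` P"
  proof
    show "C \<subseteq> Neg ` N \<union> Pos ` P"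
    proof
      fix l assume "l \<in> C"
      then show "l \<in> Neg ` N \<union> Pos ` P" by (cases l) (auto simp: N_def P_def)
    qed
  qed (auto simp: N_def P_def)
  have finNP: "finite N" "finite P"
    using assms(1) unfolding C by (auto dest!: finite_imageD simp: inj_on_def)
  have "card C = card (Neg ` N) + card (Pos ` P)"
    using finNP unfolding C by (intro card_Un_disjoint) auto
  then have cardC: "card C = card N + card P" by (simp add: card_image inj_on_def)
  have cardI: "card I \<le> card P"
    unfolding I_def using finNP(2) by (meson card_image_le card_mono finite_imageI inf_le1 order_trans)
  have NM: "N \<subseteq> M" using fals by (auto simp: N_def)
  then have N: "position n N {}" using MZ by (auto simp: position_def intro: inj_on_subset)
  have MP: "M \<inter> P = {}"
  proof (rule ccontr)
    assume "M \<inter> P \<noteq> {}"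
    then obtain p where p: "p \<in> M" "falsifies n M Z (Pos p)" using fals
      unfolding P_def by blast
    then show False
      using MZ by (auto simp: position_def dest: inj_onD)
  qed
  have "finite I" unfolding I_def using finNP by simp
  \<comment> \<open>A positive literal can cost twice, by matching its pigeon and by forbidding a
    pair; hence the factor 2 in the width bound.\<close>
  moreover have "card N + card I + card P \<le> n" using cardC cardI assms(2) by simp
  moreover have "I \<subseteq> {1..n+1}" "N \<inter> P = {}" using NM MP unfolding I_def by auto
  ultimately obtain M' where M': "position n M' {}" "N \<subseteq> M'" "M' \<inter> P = {}" "I \<subseteq> fst ` M'"
      "card M' \<le> card N + card I"
    using extend_matching[OF N finNP(2)] by meson
  have "falsifies n M' {} l" if "l \<in> C" for l
  proof (cases l)
    case (Pos p)
    then have "p \<in> P" using that by (simp add: P_def)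
    then have p: "p \<notin> M'" "fst p \<in> {1..n+1} \<Longrightarrow> fst p \<in> fst ` M'" using M' by (auto simp: I_def)
    show ?thesis
    proof (cases "fst p \<in> {1..n+1}")
      case True
      with p obtain q where "q \<in> M'" "fst q = fst p" by (metis imageE)
      moreover have "q \<noteq> p" using p(1) \<open>q \<in> M'\<close> by blast
      ultimately show ?thesis unfolding Pos falsifies.simps by blast
    next
      case False
      then have "p \<notin> {1..n+1} \<times> {1..n}" by (metis mem_Times_iff)
      then show ?thesis unfolding Pos falsifies.simps by blast
    qed
  next
    case (Neg p)
    then show ?thesis using that M' by (auto simp: N_def)
  qed
  then show ?thesis using M' cardC cardI by (intro exI[of _ M']) auto
qed

section \<open>Post-order induction over the lemmas\<close>

text \<open>Turns nodes of a subtree into positions of the whole tree not beyond its root, as an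
  induction along the post-order requires.\<close>

lemma nodes_nth_segment:
  "i < num_nodes T \<Longrightarrow> nodes T ! i = S \<Longrightarrow>
     \<exists>xs ys. nodes T = xs @ nodes S @ ys \<and> length xs + num_nodes S = Suc i"
proof (induction T arbitrary: i)
  case (Leaf C)
  then show ?case by (auto simp: num_nodes_def)
next
  case (Weaken C t)
  show ?case
  proof (cases "i < num_nodes t")
    case True
    then have "nodes t ! i = S" using Weaken.prems(2) by (simp add: num_nodes_def nth_append)
    then obtain xs ys where "nodes t = xs @ nodes S @ ys" "length xs + num_nodes S = Suc i"
      using Weaken.IH True by blast
    then show ?thesis
      by (intro exI[of _ xs] exI[of _ "ys @ [Weaken C t]"]) simp
  next
    case False
    then have "i = num_nodes t" using Weaken.prems by (simp add: num_nodes_def)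
    then show ?thesis using Weaken.prems(2)
      by (intro exI[of _ "[]"]) (auto simp: num_nodes_def)
  qed
next
  case (Resolve C l r)
  consider "i < num_nodes l" | "num_nodes l \<le> i" "i < num_nodes l + num_nodes r"
    | "i = num_nodes l + num_nodes r"
    using Resolve.prems by (fastforce simp: num_nodes_def)
  then show ?case
  proof cases
    case 1
    then have "nodes l ! i = S" using Resolve.prems(2) by (simp add: num_nodes_def nth_append)
    then obtain xs ys where "nodes l = xs @ nodes S @ ys" "length xs + num_nodes S = Suc i"
      using Resolve.IH(1) 1 by blast
    then show ?thesis
      by (intro exI[of _ xs] exI[of _ "ys @ nodes r @ [Resolve C l r]"]) simp
  next
    case 2
    let ?i = "i - num_nodes l"
    have i: "?i < num_nodes r" using 2 by simp
    then have "nodes r ! ?i = S"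
      using Resolve.prems(2) 2 by (simp add: num_nodes_def nth_append)
    then obtain xs ys where "nodes r = xs @ nodes S @ ys" "length xs + num_nodes S = Suc ?i"
      using Resolve.IH(2) i by blast
    then show ?thesis using 2(1)
      by (intro exI[of _ "nodes l @ xs"] exI[of _ "ys @ [Resolve C l r]"]) (simp add: num_nodes_def)
  next
    case 3
    then show ?thesis using Resolve.prems(2)
      by (intro exI[of _ "[]"]) (auto simp: num_nodes_def nth_append)
  qed
qed

lemma label_last_node: "label (nodes T ! (num_nodes T - 1)) = label T"
  by (cases T) (auto simp: num_nodes_def nth_append)

lemma RTLW_k_refutation_size:
  assumes ref: "RTLW_k_refutation k (FPHP n) T" and k: "2 * k \<le> n"
    and K: "0 < K" "k + K \<le> n + 1" "K \<le> n"
  shows "K ^ (n + 1 - k - K) \<le> num_nodes T"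
proof (rule ccontr)
  assume small: "\<not> ?thesis"
  have fin: "finite (label (nodes T ! i))" and corr: "correct_node (FPHP n) T i"
    if "i < num_nodes T" for i
    using ref that by (auto simp: RTLW_k_refutation_def RTLW_refutation_def)
  \<comment> \<open>If the tree is too small, no narrow label is falsifiable. This will contradict
    the empty label of the root, which every position falsifies.\<close>
  have "\<not> falsifiable n (label (nodes T ! i))"
    if "i < num_nodes T" "card (label (nodes T ! i)) \<le> k" for i
    using that
  proof (induction i rule: less_induct)
    case (less i)
    define S where "S = nodes T ! i"
    obtain xs ys where seg: "nodes T = xs @ nodes S @ ys" "length xs + num_nodes S = Suc i"
      using nodes_nth_segment[OF less.prems(1)] S_def by blast
    have steps: "derivation_step (FPHP n \<union> {C. \<not> falsifiable n C}) s"
      if s: "s \<in> set (nodes S)" for s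
    proof -
      obtain m where m: "m < num_nodes S" "s = nodes S ! m"
        using s by (auto simp: in_set_conv_nth num_nodes_def)
      define p where "p = length xs + m"
      have "nodes T ! p = (nodes S @ ys) ! m"
        by (subst seg(1)) (simp add: p_def)
      then have p: "nodes T ! p = s" "p \<le> i"
        using m seg(2) by (auto simp: nth_append num_nodes_def p_def)
      then have pT: "p < num_nodes T" using less.prems(1) by simp
      show ?thesis
      proof (cases s)
        case (Leaf C)
        show ?thesis
        proof (cases "C \<in> FPHP n")
          \<comment> \<open>A lemma copies a label from a position \<open>j < p \<le> i\<close> and
            has width at most \<open>k\<close>, so the induction hypothesis makes it
            unfalsifiable.\<close>
          case False
          then obtain j where j: "j < p" "label (nodes T ! j) = C"
            using corr[OF pT] p Leaf by (auto simp: correct_node_def)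
          have "C \<in> lemmas_of (FPHP n) T"
            using False pT p Leaf by (auto simp: lemmas_of_def num_nodes_def) (metis nth_mem)
          then have "card C \<le> k" using ref by (auto simp: RTLW_k_refutation_def)
          then have "\<not> falsifiable n C" using less.IH[of j] j p(2) less.prems(1) by simp
          then show ?thesis using Leaf by simp
        qed (simp add: Leaf)
      qed (use corr[OF pT] p in \<open>auto simp: correct_node_def\<close>)
    qed
    show ?case unfolding S_def[symmetric]
    proof
      assume "falsifiable n (label S)"
      then obtain M where M: "position n M {}" "card M \<le> card (label S)"
          "\<forall>l\<in>label S. falsifies n M {} l"
        using falsifiable_by_matching[of "label S" n] fin[OF less.prems(1)] less.prems(2) k
        unfolding S_def by (meson mult_le_mono2 order_trans)
      have "card ({1..n+1} - fst ` M) = n + 1 - card M"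
        using M(1) position_finite(1)[OF M(1)]
        by (subst card_Diff_subset) (auto simp: position_def card_image)
      then have W: "weight n K M {} = K ^ (n + 1 - card M)"
        unfolding weight_def by (simp only: Image_empty1 card.empty diff_zero prod_constant)
      \<comment> \<open>With \<open>Z\<close> empty every factor of the weight is \<open>K\<close>,
        and at most \<open>k\<close> pigeons are matched; cancelling \<open>K ^ K\<close> then
        contradicts \<open>small\<close>.\<close>
      have "K ^ (n + 1 - k - K) * K ^ K = K ^ (n + 1 - k)"
        using K by (simp flip: power_add)
      also have "\<dots> \<le> K ^ (n + 1 - card M)"
        using M(2) less.prems(2) K unfolding S_def by (intro power_increasing) auto
      also have "\<dots> \<le> num_nodes S * K ^ K"
        unfolding W[symmetric] using M K steps by (intro weight_le_num_nodes) auto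
      also have "\<dots> \<le> num_nodes T * K ^ K"
        using less.prems(1) seg(2) arg_cong[OF seg(1), of length]
        by (intro mult_right_mono) (auto simp: num_nodes_def)
      finally show False using small K by simp
    qed
  qed
  moreover have "num_nodes T - 1 < num_nodes T" by (cases T) (auto simp: num_nodes_def)
  moreover have "label T = {}" using ref by (simp add: RTLW_k_refutation_def RTLW_refutation_def)
  moreover have "falsifiable n {}" unfolding falsifiable_def
    by (intro exI[of _ "{}"]) (simp add: position_def)
  ultimately show False using label_last_node[of T] by (metis card.empty zero_le)
qed

section \<open>The asymptotic bound\<close>

theorem theorem8p6:
  "\<exists>c::real. c > 0 \<and>
     (\<forall>\<^sub>F n in sequentially. \<forall>k::nat. real k \<le> real n / 2 \<longrightarrow>
        (\<forall>T. RTLW_k_refutation k (FPHP n) T \<longrightarrow>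
           real (num_nodes T) \<ge> 2 powr (c * real n * log 2 (real n))))"
proof (intro exI[of _ "1/8"] conjI eventually_sequentiallyI[of 64] allI impI)
  fix n k :: nat and T :: "(nat \<times> nat) dtree"
  assume n: "64 \<le> n" and "real k \<le> real n / 2" and ref: "RTLW_k_refutation k (FPHP n) T"
  then have k: "2 * k \<le> n" by linarith
  \<comment> \<open>Then the exponent \<open>n + 1 - k - K\<close> is at least \<open>n / 4\<close>
    and the base \<open>K\<close> at least \<open>sqrt n\<close>. This yields
    \<open>n powr (n / 8)\<close>, whence the constant \<open>1/8\<close>.\<close>
  define K where "K = n div 4"
  have K: "0 < K" "4 * K \<le> n" "n \<le> 8 * K" using n unfolding K_def by linarith+
  \<comment> \<open>This inequality is the source of the threshold 64.\<close>
  have "(real n / 8)\<^sup>2 \<ge> real n" using n by (simp add: power2_eq_square field_simps)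
  then have sqrt_le: "sqrt (real n) \<le> real K"
    using K(3) by (intro order_trans[OF real_le_lsqrt[of "real n / 8"]]) auto
  have "2 powr (1/8 * real n * log 2 (real n)) = (2 powr log 2 (real n)) powr (real n / 8)"
    by (simp add: powr_powr mult.commute)
  also have "\<dots> = real n powr (real n / 8)" using n by simp
  also have "\<dots> = sqrt (real n) powr (real n / 4)"
    by (simp add: powr_half_sqrt[symmetric] powr_powr)
  also have "\<dots> \<le> real K powr (real n / 4)" using sqrt_le by (intro powr_mono2) auto
  also have "\<dots> \<le> real K powr real (n + 1 - k - K)"
  proof (rule powr_mono)
    show "real n / 4 \<le> real (n + 1 - k - K)" using k K by linarith
  qed (use K in simp)
  also have "\<dots> = real (K ^ (n + 1 - k - K))" using K by (simp add: powr_realpow)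
  also have "\<dots> \<le> real (num_nodes T)"
    using RTLW_k_refutation_size[OF ref k K(1)] k K by simp
  finally show "2 powr (1/8 * real n * log 2 (real n)) \<le> real (num_nodes T)" .
qed simp

end
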